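(* Let $\mathbb{F}$ be a field and let $\mathbf{L}=\mathbf{V}\rtimes\mathbb{F}e_0$ be an indecomposable almost Abelian Lie algebra over $\mathbb{F}$. Then the algebra of derivations $\mathrm{Der}(\mathbf{L})$ consists of exactly the operators $$\begin{pmatrix}\Delta&\gamma\\ \beta^\top&\alpha\end{pmatrix},\qquad \alpha\in\mathbb{F},\ \beta^\top\in\mathbf{V}^*,\ \gamma\in\mathbf{V},\ \Delta\in\mathrm{End}_{\mathbb{F}}(\mathbf{V}),$$ such that $$[\mathbf{L},\mathbf{L}]\subset\ker\beta^\top,\qquad(\Delta-\alpha\mathbf{1})\,\mathrm{ad}_{e_0}-\mathrm{ad}_{e_0}\Delta=0,$$ and, in case $\mathbf{L}$ is not isomorphic to the Heisenberg algebra $\mathbf{H}_{\mathbb{F}}$, additionally $\beta^\top=0$.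
   Context: An almost Abelian Lie algebra over a field $\mathbb{F}$ (of arbitrary, possibly infinite, dimension) is a non-Abelian Lie algebra that contains a codimension 1 Abelian subalgebra; it then has a codimension 1 Abelian ideal. Writing $\mathbf{L}=\mathbf{V}\rtimes\mathbb{F}e_0$ means: $\mathbf{V}\subset\mathbf{L}$ is a codimension 1 Abelian ideal, $e_0\in\mathbf{L}\setminus\mathbf{V}$, and $\mathbf{L}=\mathbf{V}\oplus\mathbb{F}e_0$ as vector spaces. The operator $\mathrm{ad}_{e_0}\in\mathrm{End}_{\mathbb{F}}(\mathbf{V})$ is $v\mapsto[e_0,v]$; it is nonzero, and $[\mathbf{L},\mathbf{L}]=\mathrm{ad}_{e_0}\mathbf{V}\subset\mathbf{V}$. A Lie algebra is decomposable if it is the direct sum of two commuting nonzero Lie subalgebras; otherwise it is indecomposable. $\mathbf{V}^*$ is the space of all linear functionals on $\mathbf{V}$ and $\mathbf{1}$ is the identity operator. The matrix $\begin{pmatrix}\Delta&\gamma\\ \beta^\top&\alpha\end{pmatrix}$ denotes the linear map of $\mathbf{L}$ sending $v+te_0$ to $(\Delta v+t\gamma)+(\beta^\top v+\alpha t)e_0$ for $v\in\mathbf{V}$, $t\in\mathbb{F}$. $\mathbf{H}_{\mathbb{F}}$ is the 3-dimensional Lie algebra with basis $e_0,e_1,e_2$ and $[e_0,e_2]=e_1$, $[e_0,e_1]=[e_1,e_2]=0$. *)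

theory Defs
  imports Complex_Main "HOL-Library.Product_Plus"
begin

locale lie_algebra = vector_space scale
  for scale :: "'f::field \<Rightarrow> 'l::ab_group_add \<Rightarrow> 'l" +
  fixes bracket :: "'l \<Rightarrow> 'l \<Rightarrow> 'l"
  assumes linear_bracket_right: "Vector_Spaces.linear scale scale (bracket x)"
    and linear_bracket_left: "Vector_Spaces.linear scale scale (\<lambda>x. bracket x y)"
    and bracket_self: "bracket x x = 0"
    and jacobi: "bracket x (bracket y z) + bracket y (bracket z x) + bracket z (bracket x y) = 0"

text \<open>
  Maps out of a subspace \<open>V\<close> are represented by total functions whose values
  outside \<open>V\<close> are irrelevant.
\<close>

definition linear_on ::
  "'a::ab_group_add set \<Rightarrow> ('f::field \<Rightarrow> 'a \<Rightarrow> 'a) \<Rightarrow> ('f \<Rightarrow> 'b::ab_group_add \<Rightarrow> 'b) \<Rightarrow> ('a \<Rightarrow> 'b) \<Rightarrow> bool"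
  where "linear_on V s1 s2 f \<longleftrightarrow>
    (\<forall>x\<in>V. \<forall>y\<in>V. f (x + y) = f x + f y) \<and> (\<forall>c. \<forall>x\<in>V. f (s1 c x) = s2 c (f x))"

definition lie_isomorphic ::
  "('f::field \<Rightarrow> 'a::ab_group_add \<Rightarrow> 'a) \<Rightarrow> ('a \<Rightarrow> 'a \<Rightarrow> 'a) \<Rightarrow>
   ('f \<Rightarrow> 'b::ab_group_add \<Rightarrow> 'b) \<Rightarrow> ('b \<Rightarrow> 'b \<Rightarrow> 'b) \<Rightarrow> bool"
  where "lie_isomorphic s1 b1 s2 b2 \<longleftrightarrow>
    (\<exists>\<phi>. Vector_Spaces.linear s1 s2 \<phi> \<and> bij \<phi> \<and> (\<forall>x y. \<phi> (b1 x y) = b2 (\<phi> x) (\<phi> y)))"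

context lie_algebra
begin

definition abelian_on :: "'l set \<Rightarrow> bool"
  where "abelian_on U \<longleftrightarrow> (\<forall>x\<in>U. \<forall>y\<in>U. bracket x y = 0)"

definition lie_subalgebra :: "'l set \<Rightarrow> bool"
  where "lie_subalgebra U \<longleftrightarrow> subspace U \<and> (\<forall>x\<in>U. \<forall>y\<in>U. bracket x y \<in> U)"

definition lie_ideal :: "'l set \<Rightarrow> bool"
  where "lie_ideal U \<longleftrightarrow> subspace U \<and> (\<forall>x. \<forall>y\<in>U. bracket x y \<in> U)"

definition is_direct_sum :: "'l set \<Rightarrow> 'l set \<Rightarrow> bool"
  where "is_direct_sum U W \<longleftrightarrow>
    subspace U \<and> subspace W \<and> U \<inter> W = {0} \<and> {u + w | u w. u \<in> U \<and> w \<in> W} = UNIV"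

definition codim_1 :: "'l set \<Rightarrow> bool"
  where "codim_1 U \<longleftrightarrow> (\<exists>W. is_direct_sum U W \<and> dim W = 1)"

definition almost_abelian :: bool
  where "almost_abelian \<longleftrightarrow>
    \<not> abelian_on UNIV \<and> (\<exists>U. lie_subalgebra U \<and> abelian_on U \<and> codim_1 U)"

definition decomposable :: bool
  where "decomposable \<longleftrightarrow>
    (\<exists>A B. lie_subalgebra A \<and> lie_subalgebra B \<and> A \<noteq> {0} \<and> B \<noteq> {0} \<and>
      is_direct_sum A B \<and> (\<forall>a\<in>A. \<forall>b\<in>B. bracket a b = 0))"

definition semidirect_decomposition :: "'l set \<Rightarrow> 'l \<Rightarrow> bool"
  where "semidirect_decomposition V e0 \<longleftrightarrow>
    lie_ideal V \<and> abelian_on V \<and> codim_1 V \<and> e0 \<notin> V \<and> is_direct_sum V (span {e0})"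

definition derived_algebra :: "'l set"
  where "derived_algebra = span {bracket x y | x y. True}"

definition derivations :: "('l \<Rightarrow> 'l) set"
  where "derivations = {D. Vector_Spaces.linear scale scale D \<and>
    (\<forall>x y. D (bracket x y) = bracket (D x) y + bracket x (D y))}"

definition endomorphisms_on :: "'l set \<Rightarrow> ('l \<Rightarrow> 'l) set"
  where "endomorphisms_on V = {f. linear_on V scale scale f \<and> f ` V \<subseteq> V}"

definition dual_on :: "'l set \<Rightarrow> ('l \<Rightarrow> 'f) set"
  where "dual_on V = {f. linear_on V scale (*) f}"

text \<open>
  The description below is unique only if the space is the direct sum of \<open>V\<close>
  and the line spanned by \<open>e0\<close>, with \<open>e0\<close> not in \<open>V\<close>;
  see \<open>block_operator_apply\<close>.
\<close>

definition block_operator ::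
  "'l set \<Rightarrow> 'l \<Rightarrow> ('l \<Rightarrow> 'l) \<Rightarrow> 'l \<Rightarrow> ('l \<Rightarrow> 'f) \<Rightarrow> 'f \<Rightarrow> 'l \<Rightarrow> 'l"
  where "block_operator V e0 \<Delta> \<gamma> \<beta> \<alpha> x =
    (THE y. \<exists>v\<in>V. \<exists>t. x = v + scale t e0 \<and>
       y = (\<Delta> v + scale t \<gamma>) + scale (\<beta> v + \<alpha> * t) e0)"

lemma block_operator_apply:
  assumes "semidirect_decomposition V e0" and v: "v \<in> V"
  shows "block_operator V e0 \<Delta> \<gamma> \<beta> \<alpha> (v + scale t e0) =
    (\<Delta> v + scale t \<gamma>) + scale (\<beta> v + \<alpha> * t) e0"
proof -
  have V: "subspace V" and e0: "e0 \<notin> V"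
    using assms(1) by (auto simp: semidirect_decomposition_def lie_ideal_def)
  have uniq: "v = w \<and> t = s" if w: "w \<in> V" and eq: "v + scale t e0 = w + scale s e0" for w s
  proof -
    have d: "v - w = scale (s - t) e0"
      using eq by (simp add: scale_left_diff_distrib algebra_simps)
    have "s = t"
    proof (rule ccontr)
      assume "s \<noteq> t"
      then have "e0 = scale (inverse (s - t)) (v - w)"
        by (simp add: d)
      then show False
        using e0 subspace_scale[OF V subspace_diff[OF V v w]] by metis
    qed
    with d show ?thesis by simp
  qed
  show ?thesis
    unfolding block_operator_def
    by (rule the_equality) (use v uniq in blast)+
qed

end

text \<open>A triple \<open>(x0, x1, x2)\<close> stands for \<open>x0 e0 + x1 e1 + x2 e2\<close>.\<close>

definition heisenberg_scale :: "'f::field \<Rightarrow> 'f \<times> 'f \<times> 'f \<Rightarrow> 'f \<times> 'f \<times> 'f"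
  where "heisenberg_scale c = (\<lambda>(x0, x1, x2). (c * x0, c * x1, c * x2))"

definition heisenberg_bracket :: "'f::field \<times> 'f \<times> 'f \<Rightarrow> 'f \<times> 'f \<times> 'f \<Rightarrow> 'f \<times> 'f \<times> 'f"
  where "heisenberg_bracket = (\<lambda>(x0, x1, x2) (y0, y1, y2). (0, x0 * y2 - x2 * y0, 0))"

lemma heisenberg_basis_brackets:
  "heisenberg_bracket (1, 0, 0) (0, 0, 1) = (0, 1, 0)"
  "heisenberg_bracket (1, 0, 0) (0, 1, 0) = 0"
  "heisenberg_bracket (0, 1, 0) (0, 0, 1) = 0"
  by (simp_all add: heisenberg_bracket_def zero_prod_def)

lemma lie_algebra_heisenberg: "lie_algebra heisenberg_scale heisenberg_bracket"
proof -
  interpret vector_space heisenberg_scale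
    by standard (auto simp: heisenberg_scale_def algebra_simps)
  show ?thesis
    by standard
      (auto simp: heisenberg_scale_def heisenberg_bracket_def zero_prod_def algebra_simps)
qed

end

theory Submission
  imports Defs
begin

text \<open>
  Write \<open>T\<close> for the operator \<open>v \<mapsto> [e0, v]\<close> on \<open>V\<close>. Every linear map \<open>D\<close> of the Lie algebra has
  a block form, so the question is when a block operator satisfies the Leibniz rule. Since
  \<open>[v + t e0, w + s e0] = T (t w - s v)\<close>, the rule has to be tested only on pairs \<open>(e0, v)\<close> and
  \<open>(v, w)\<close> with \<open>v\<close>, \<open>w\<close> in \<open>V\<close>. The pairs \<open>(e0, v)\<close> give \<open>\<beta> \<circ> T = 0\<close> and
  \<open>(\<Delta> - \<alpha>) T - T \<Delta> = 0\<close>. The pairs \<open>(v, w)\<close> give the exchange identity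
  \<open>\<beta>(v) T w = \<beta>(w) T v\<close> (lemma \<open>block_operator_derivation_iff\<close>). The theorem therefore says that,
  given \<open>\<beta> \<circ> T = 0\<close>, the exchange identity means that \<open>\<beta> = 0\<close> or the algebra is the Heisenberg
  algebra.

  If the exchange identity holds and \<open>\<beta> u = 1\<close>, then \<open>T w = \<beta>(w) T u\<close>, so \<open>T\<close> has rank one and
  kernel \<open>ker \<beta>\<close>, which contains \<open>e1 = T u\<close>. The vectors \<open>e0, e1, u\<close> span a Heisenberg algebra,
  and any complement of \<open>e1\<close> in \<open>ker \<beta>\<close> is central and splits off as a direct summand; by
  indecomposability it vanishes (lemma \<open>heisenberg_if_exchange\<close>).

  Conversely, in the Heisenberg algebra \<open>T\<close> has rank one and its kernel in \<open>V\<close> is its own image, the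
  centre. A functional that vanishes on the image of \<open>T\<close> thus vanishes on its kernel, so it
  is determined by \<open>T\<close> up to a factor, and the exchange identity follows (lemma
  \<open>exchange_if_heisenberg\<close>).
\<close>

section \<open>Bilinearity and isomorphisms\<close>

lemma linear_iff_linear_on_UNIV:
  assumes "vector_space s1" and "vector_space s2"
  shows "Vector_Spaces.linear s1 s2 f \<longleftrightarrow> linear_on UNIV s1 s2 f"
  using assms
  by (auto simp: linear_on_def Vector_Spaces.linear_iff_module_hom module_hom_iff
      module_iff_vector_space)

context lie_algebra
begin

lemma bracket_add_right: "bracket x (y + z) = bracket x y + bracket x z"
  and bracket_diff_right: "bracket x (y - z) = bracket x y - bracket x z"
  and bracket_scale_right: "bracket x (scale c y) = scale c (bracket x y)"
  and bracket_zero_right: "bracket x 0 = 0"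
proof -
  interpret Vector_Spaces.linear scale scale "bracket x" by (rule linear_bracket_right)
  show "bracket x (y + z) = bracket x y + bracket x z"
    "bracket x (y - z) = bracket x y - bracket x z"
    "bracket x (scale c y) = scale c (bracket x y)" "bracket x 0 = 0"
    by (simp_all add: add diff scale)
qed

lemma bracket_add_left: "bracket (x + y) z = bracket x z + bracket y z"
  and bracket_diff_left: "bracket (x - y) z = bracket x z - bracket y z"
  and bracket_scale_left: "bracket (scale c x) z = scale c (bracket x z)"
  and bracket_zero_left: "bracket 0 z = 0"
proof -
  interpret Vector_Spaces.linear scale scale "\<lambda>x. bracket x z" by (rule linear_bracket_left)
  show "bracket (x + y) z = bracket x z + bracket y z"
    "bracket (x - y) z = bracket x z - bracket y z"
    "bracket (scale c x) z = scale c (bracket x z)" "bracket 0 z = 0"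
    by (simp_all add: add diff scale)
qed

lemmas bracket_bilinear = bracket_add_right bracket_diff_right bracket_scale_right bracket_zero_right
  bracket_add_left bracket_diff_left bracket_scale_left bracket_zero_left

lemma bracket_swap: "bracket x y = - bracket y x"
proof -
  have "bracket x y + bracket y x = bracket (x + y) (x + y)"
    by (simp add: bracket_add_left bracket_add_right bracket_self[of x] bracket_self[of y])
  also have "\<dots> = 0" by (rule bracket_self)
  finally have "bracket x y + bracket y x = 0" .
  then show ?thesis by (rule eq_neg_iff_add_eq_0[THEN iffD2])
qed

end

lemma lie_isomorphic_sym:
  assumes "lie_isomorphic s1 b1 s2 b2"
  shows "lie_isomorphic s2 b2 s1 b1"
proof -
  obtain \<phi> where lin: "Vector_Spaces.linear s1 s2 \<phi>" and bij: "bij \<phi>"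
    and hom: "\<And>x y. \<phi> (b1 x y) = b2 (\<phi> x) (\<phi> y)"
    using assms by (auto simp: lie_isomorphic_def)
  interpret Vector_Spaces.linear s1 s2 \<phi> by (rule lin)
  have r: "\<phi> (inv \<phi> y) = y" for y using bij by (simp add: bij_is_surj surj_f_inv_f)
  have l: "inv \<phi> y = x" if "\<phi> x = y" for x y using bij that by (metis bij_inv_eq_iff)
  have "Vector_Spaces.linear s2 s1 (inv \<phi>)"
    unfolding linear_iff_linear_on_UNIV[OF vs2.vector_space_axioms vs1.vector_space_axioms]
    by (auto simp: linear_on_def add scale r intro!: l)
  moreover have "inv \<phi> (b2 x y) = b1 (inv \<phi> x) (inv \<phi> y)" for x y
    by (rule l) (simp add: hom r)
  ultimately show ?thesis
    unfolding lie_isomorphic_def using bij_imp_bij_inv[OF bij] by blast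
qed

section \<open>Block form of linear maps and of the Leibniz rule\<close>

locale abelian_ideal_decomposition = lie_algebra scale bracket
  for scale :: "'f::field \<Rightarrow> 'l::ab_group_add \<Rightarrow> 'l" and bracket +
  fixes V :: "'l set" and e0 :: 'l
  assumes decomposition: "semidirect_decomposition V e0"
begin

lemma subspace_V: "subspace V"
  and bracket_in_V: "v \<in> V \<Longrightarrow> bracket x v \<in> V"
  and abelian_V: "v \<in> V \<Longrightarrow> w \<in> V \<Longrightarrow> bracket v w = 0"
  and e0_notin_V: "e0 \<notin> V"
  using decomposition
  by (auto simp: semidirect_decomposition_def lie_ideal_def abelian_on_def)

lemmas V_closed = subspace_add[OF subspace_V] subspace_diff[OF subspace_V]
  subspace_scale[OF subspace_V] subspace_0[OF subspace_V] bracket_in_V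

lemma decompose:
  obtains v t where "v \<in> V" and "x = v + scale t e0"
proof -
  have "x \<in> {u + w | u w. u \<in> V \<and> w \<in> span {e0}}"
    using decomposition by (auto simp: semidirect_decomposition_def is_direct_sum_def)
  then show ?thesis using that by (auto simp: span_singleton)
qed

definition e0_coordinate :: "'l \<Rightarrow> 'f"
  where "e0_coordinate x = (THE t. x - scale t e0 \<in> V)"

lemma e0_coordinate_eqI:
  assumes "x - scale t e0 \<in> V"
  shows "e0_coordinate x = t"
  unfolding e0_coordinate_def
proof (rule the_equality)
  fix s assume "x - scale s e0 \<in> V"
  then have "(x - scale s e0) - (x - scale t e0) \<in> V" using assms by (rule V_closed)
  then have *: "scale (t - s) e0 \<in> V" by (simp add: scale_left_diff_distrib)
  show "s = t"
  proof (rule ccontr)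
    assume "s \<noteq> t"
    then have "e0 = scale (inverse (t - s)) (scale (t - s) e0)" by simp
    then show False using e0_notin_V V_closed(3)[OF *] by metis
  qed
qed (rule assms)

lemma V_component: "x - scale (e0_coordinate x) e0 \<in> V"
proof -
  obtain v t where "v \<in> V" "x = v + scale t e0" by (rule decompose)
  then have "x - scale t e0 \<in> V" by simp
  then show ?thesis using e0_coordinate_eqI by metis
qed

lemma e0_coordinate_sum: "v \<in> V \<Longrightarrow> e0_coordinate (v + scale t e0) = t"
  by (rule e0_coordinate_eqI) simp

lemma e0_coordinate_add: "e0_coordinate (x + y) = e0_coordinate x + e0_coordinate y"
  using V_closed(1)[OF V_component V_component, of x y]
  by (intro e0_coordinate_eqI) (simp add: scale_left_distrib algebra_simps)

lemma e0_coordinate_scale: "e0_coordinate (scale c x) = c * e0_coordinate x"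
  using V_closed(3)[OF V_component, of c x]
  by (intro e0_coordinate_eqI) (simp add: scale_right_diff_distrib)

lemma decomposition_unique:
  assumes "v \<in> V" "w \<in> V" "v + scale t e0 = w + scale s e0"
  shows "v = w \<and> t = s"
  using assms e0_coordinate_sum by (metis add_right_cancel)

lemma bracket_decomposed:
  assumes "v \<in> V" "w \<in> V"
  shows "bracket (v + scale t e0) (w + scale s e0) = bracket e0 (scale t w - scale s v)"
  using assms
  by (simp add: bracket_bilinear abelian_V bracket_self bracket_swap[of v e0])

text \<open>
  Each bracket already has the form \<open>[e0, v]\<close> with \<open>v\<close> in \<open>V\<close>, so only these have to be tested.
\<close>

lemma derived_algebra_subset_kernel_iff:
  assumes "\<beta> \<in> dual_on V"
  shows "derived_algebra \<subseteq> {v \<in> V. \<beta> v = 0} \<longleftrightarrow> (\<forall>v\<in>V. \<beta> (bracket e0 v) = 0)"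
proof
  assume "derived_algebra \<subseteq> {v \<in> V. \<beta> v = 0}"
  moreover have "bracket e0 v \<in> derived_algebra" for v
    unfolding derived_algebra_def by (rule span_base) blast
  ultimately show "\<forall>v\<in>V. \<beta> (bracket e0 v) = 0" by blast
next
  assume *: "\<forall>v\<in>V. \<beta> (bracket e0 v) = 0"
  have lin: "\<And>x y. x \<in> V \<Longrightarrow> y \<in> V \<Longrightarrow> \<beta> (x + y) = \<beta> x + \<beta> y"
    "\<And>c x. x \<in> V \<Longrightarrow> \<beta> (scale c x) = c * \<beta> x"
    using assms by (auto simp: dual_on_def linear_on_def)
  have "\<beta> 0 = 0" using lin(2)[of 0 0] V_closed by simp
  then have "subspace {v \<in> V. \<beta> v = 0}"
    by (auto simp: subspace_def lin V_closed)
  moreover have "bracket x y \<in> {v \<in> V. \<beta> v = 0}" for x y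
  proof -
    obtain v t w s where "v \<in> V" "w \<in> V" "x = v + scale t e0" "y = w + scale s e0"
      by (metis decompose)
    then show ?thesis using * by (simp add: bracket_decomposed V_closed)
  qed
  ultimately show "derived_algebra \<subseteq> {v \<in> V. \<beta> v = 0}"
    unfolding derived_algebra_def by (intro span_minimal) auto
qed

lemma linear_eq_block_operator:
  assumes "Vector_Spaces.linear scale scale D"
  obtains \<Delta> \<gamma> \<beta> \<alpha> where "D = block_operator V e0 \<Delta> \<gamma> \<beta> \<alpha>"
    and "\<beta> \<in> dual_on V" "\<gamma> \<in> V" "\<Delta> \<in> endomorphisms_on V"
proof -
  interpret D: Vector_Spaces.linear scale scale D by (rule assms)
  let ?\<beta> = "\<lambda>v. e0_coordinate (D v)"
  let ?\<Delta> = "\<lambda>v. D v - scale (?\<beta> v) e0"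
  let ?block = "block_operator V e0 ?\<Delta> (?\<Delta> e0) ?\<beta> (?\<beta> e0)"
  have "D x = ?block x" for x
  proof -
    obtain v t where v: "v \<in> V" and x: "x = v + scale t e0" by (rule decompose)
    show ?thesis
      unfolding x block_operator_apply[OF decomposition v]
      by (simp add: D.add D.scale algebra_simps)
  qed
  then have "D = ?block" by (rule ext)
  moreover have "?\<beta> \<in> dual_on V"
    by (simp add: dual_on_def linear_on_def D.add D.scale e0_coordinate_add e0_coordinate_scale)
  moreover have "?\<Delta> \<in> endomorphisms_on V"
    by (auto simp: endomorphisms_on_def linear_on_def D.add D.scale V_component
        e0_coordinate_add e0_coordinate_scale algebra_simps)
  ultimately show ?thesis using that[OF _ _ V_component] by blast
qed

lemma linear_block_operator:
  assumes \<beta>: "\<beta> \<in> dual_on V" and \<Delta>: "\<Delta> \<in> endomorphisms_on V"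
  shows "Vector_Spaces.linear scale scale (block_operator V e0 \<Delta> \<gamma> \<beta> \<alpha>)"
proof -
  let ?D = "block_operator V e0 \<Delta> \<gamma> \<beta> \<alpha>"
  have lin: "\<And>x y. x \<in> V \<Longrightarrow> y \<in> V \<Longrightarrow> \<beta> (x + y) = \<beta> x + \<beta> y"
    "\<And>c x. x \<in> V \<Longrightarrow> \<beta> (scale c x) = c * \<beta> x"
    "\<And>x y. x \<in> V \<Longrightarrow> y \<in> V \<Longrightarrow> \<Delta> (x + y) = \<Delta> x + \<Delta> y"
    "\<And>c x. x \<in> V \<Longrightarrow> \<Delta> (scale c x) = scale c (\<Delta> x)"
    using \<beta> \<Delta> by (auto simp: dual_on_def endomorphisms_on_def linear_on_def)
  note app = block_operator_apply[OF decomposition]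
  have "?D (x + y) = ?D x + ?D y" for x y
  proof -
    obtain v t w s where v: "v \<in> V" and w: "w \<in> V"
      and x: "x = v + scale t e0" and y: "y = w + scale s e0"
      by (metis decompose)
    have "x + y = (v + w) + scale (t + s) e0" by (simp add: x y algebra_simps)
    then have "?D (x + y) = \<Delta> (v + w) + scale (t + s) \<gamma> + scale (\<beta> (v + w) + \<alpha> * (t + s)) e0"
      using app[OF V_closed(1)[OF v w]] by simp
    then show ?thesis
      by (simp add: x y v w app lin algebra_simps)
  qed
  moreover have "?D (scale c x) = scale c (?D x)" for c x
  proof -
    obtain v t where v: "v \<in> V" and x: "x = v + scale t e0" by (rule decompose)
    have "scale c x = scale c v + scale (c * t) e0" by (simp add: x algebra_simps)
    then have "?D (scale c x) =
        \<Delta> (scale c v) + scale (c * t) \<gamma> + scale (\<beta> (scale c v) + \<alpha> * (c * t)) e0"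
      using app[OF V_closed(3)[OF v]] by simp
    then show ?thesis
      by (simp add: x v app lin algebra_simps)
  qed
  ultimately show ?thesis
    by (simp add: linear_iff_linear_on_UNIV vector_space_axioms linear_on_def)
qed

text \<open>
  For \<open>x = v + t e0\<close> and \<open>y = w + s e0\<close> the terms of the Leibniz rule that contain \<open>\<gamma>\<close> cancel. What
  remains is a combination, with coefficients \<open>t\<close>, \<open>s\<close> and \<open>1\<close>, of the three identities on the right;
  the pairs \<open>(e0, v)\<close> and \<open>(v, w)\<close> isolate them.
\<close>

lemma block_operator_derivation_iff:
  assumes \<beta>: "\<beta> \<in> dual_on V" and \<gamma>: "\<gamma> \<in> V" and \<Delta>: "\<Delta> \<in> endomorphisms_on V"
  shows "block_operator V e0 \<Delta> \<gamma> \<beta> \<alpha> \<in> derivations \<longleftrightarrow>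
    (\<forall>v\<in>V. \<beta> (bracket e0 v) = 0) \<and>
    (\<forall>v\<in>V. (\<Delta> (bracket e0 v) - scale \<alpha> (bracket e0 v)) - bracket e0 (\<Delta> v) = 0) \<and>
    (\<forall>v\<in>V. \<forall>w\<in>V. scale (\<beta> v) (bracket e0 w) = scale (\<beta> w) (bracket e0 v))"
    (is "?D \<in> _ \<longleftrightarrow> ?ker \<and> ?comm \<and> ?exchange")
proof -
  have \<Delta>V: "\<Delta> v \<in> V" if "v \<in> V" for v using \<Delta> that by (auto simp: endomorphisms_on_def)
  have lin: "\<And>c x. x \<in> V \<Longrightarrow> \<beta> (scale c x) = c * \<beta> x"
    "\<And>c x. x \<in> V \<Longrightarrow> \<Delta> (scale c x) = scale c (\<Delta> x)"
    using \<beta> \<Delta> by (auto simp: dual_on_def endomorphisms_on_def linear_on_def)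
  have zero: "\<beta> 0 = 0" "\<Delta> 0 = 0" using lin[of 0 0] V_closed by simp_all
  note app = block_operator_apply[OF decomposition]
  interpret D: Vector_Spaces.linear scale scale ?D by (rule linear_block_operator[OF \<beta> \<Delta>])
  have DV: "?D v = \<Delta> v + scale (\<beta> v) e0" if "v \<in> V" for v
    using app[OF that, of _ _ _ _ 0] by simp
  have De0: "?D e0 = \<gamma> + scale \<alpha> e0"
    using app[of 0 _ _ _ _ 1] V_closed(4) by (simp add: zero)
  show ?thesis
  proof
    assume "?D \<in> derivations"
    then have leib: "?D (bracket x y) = bracket (?D x) y + bracket x (?D y)" for x y
      by (simp add: derivations_def)
    have mixed: "\<Delta> (bracket e0 v) = scale \<alpha> (bracket e0 v) + bracket e0 (\<Delta> v)
        \<and> \<beta> (bracket e0 v) = 0" if v: "v \<in> V" for v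
    proof (rule decomposition_unique)
      show "\<Delta> (bracket e0 v) + scale (\<beta> (bracket e0 v)) e0 =
          scale \<alpha> (bracket e0 v) + bracket e0 (\<Delta> v) + scale 0 e0"
        using leib[of e0 v] v \<gamma>
        by (simp add: DV De0 V_closed bracket_bilinear abelian_V bracket_self)
    qed (use v \<Delta>V V_closed in auto)
    have "scale (\<beta> v) (bracket e0 w) = scale (\<beta> w) (bracket e0 v)" if "v \<in> V" "w \<in> V" for v w
      using leib[of v w] that
      by (simp add: DV abelian_V D.zero \<Delta>V bracket_bilinear bracket_swap[of v e0])
    then show "?ker \<and> ?comm \<and> ?exchange" using mixed by (simp add: algebra_simps)
  next
    assume "?ker \<and> ?comm \<and> ?exchange"
    then have ker: "\<And>v. v \<in> V \<Longrightarrow> \<beta> (bracket e0 v) = 0"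
      and comm: "\<And>v. v \<in> V \<Longrightarrow> \<Delta> (bracket e0 v) = scale \<alpha> (bracket e0 v) + bracket e0 (\<Delta> v)"
      and exch: "\<And>v w. v \<in> V \<Longrightarrow> w \<in> V \<Longrightarrow>
        scale (\<beta> v) (bracket e0 w) = scale (\<beta> w) (bracket e0 v)"
      by (auto simp: algebra_simps)
    have "?D (bracket x y) = bracket (?D x) y + bracket x (?D y)" for x y
    proof -
      obtain v t w s where v: "v \<in> V" and w: "w \<in> V"
        and x: "x = v + scale t e0" and y: "y = w + scale s e0"
        by (metis decompose)
      have Dv: "\<Delta> v + scale t \<gamma> \<in> V" and Dw: "\<Delta> w + scale s \<gamma> \<in> V"
        using v w \<gamma> \<Delta>V V_closed by auto
      have "bracket x y = scale t (bracket e0 w) - scale s (bracket e0 v)"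
        unfolding x y bracket_decomposed[OF v w] by (simp add: bracket_bilinear)
      then have "?D (bracket x y) = scale t (?D (bracket e0 w)) - scale s (?D (bracket e0 v))"
        by (simp add: D.diff D.scale)
      also have "\<dots> = scale t (scale \<alpha> (bracket e0 w) + bracket e0 (\<Delta> w))
          - scale s (scale \<alpha> (bracket e0 v) + bracket e0 (\<Delta> v))"
        by (simp add: DV v w V_closed ker comm)
      also have "\<dots> = bracket (?D x) y + bracket x (?D y)"
        unfolding x y app[OF v] app[OF w] bracket_decomposed[OF Dv w] bracket_decomposed[OF v Dw]
        by (simp add: bracket_bilinear exch[OF v w] algebra_simps)
      finally show ?thesis .
    qed
    then show "?D \<in> derivations" by (simp add: derivations_def D.linear_axioms)
  qed
qed

section \<open>The exchange identity and the Heisenberg algebra\<close>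

text \<open>
  The functional \<open>\<beta>\<close> is normalised to \<open>\<beta> u = 1\<close>, so that \<open>e0\<close>, \<open>[e0, u]\<close>, \<open>u\<close> is a Heisenberg basis of
  the subspace it spans. That \<open>[e0, u]\<close> is nonzero comes from non-commutativity, and that it commutes with
  \<open>e0\<close> comes from \<open>\<beta> [e0, u] = 0\<close>.
\<close>

lemma heisenberg_if_exchange:
  assumes nonabelian: "\<not> abelian_on UNIV" and indecomposable: "\<not> decomposable"
    and \<beta>: "\<beta> \<in> dual_on V" and ker: "\<And>v. v \<in> V \<Longrightarrow> \<beta> (bracket e0 v) = 0"
    and exch: "\<And>v w. v \<in> V \<Longrightarrow> w \<in> V \<Longrightarrow>
      scale (\<beta> v) (bracket e0 w) = scale (\<beta> w) (bracket e0 v)"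
    and nonzero: "v0 \<in> V" "\<beta> v0 \<noteq> 0"
  shows "lie_isomorphic scale bracket heisenberg_scale heisenberg_bracket"
proof -
  have lin: "\<And>x y. x \<in> V \<Longrightarrow> y \<in> V \<Longrightarrow> \<beta> (x + y) = \<beta> x + \<beta> y"
    "\<And>c x. x \<in> V \<Longrightarrow> \<beta> (scale c x) = c * \<beta> x"
    using \<beta> by (auto simp: dual_on_def linear_on_def)
  have \<beta>_zero: "\<beta> 0 = 0" using lin(2)[of 0 0] V_closed by simp
  define u where "u = scale (inverse (\<beta> v0)) v0"
  have u: "u \<in> V" "\<beta> u = 1" using nonzero by (simp_all add: u_def V_closed lin)
  define e1 where "e1 = bracket e0 u"
  have rank1: "bracket e0 w = scale (\<beta> w) e1" if "w \<in> V" for w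
    using exch[OF u(1) that] u(2) by (simp add: e1_def)
  have e1: "e1 \<in> V" "\<beta> e1 = 0" unfolding e1_def using u ker V_closed by auto
  have e1_nz: "e1 \<noteq> 0"
  proof
    assume "e1 = 0"
    have "bracket x y = 0" for x y
    proof -
      obtain v t w s where "v \<in> V" "w \<in> V" "x = v + scale t e0" "y = w + scale s e0"
        by (metis decompose)
      then show ?thesis using \<open>e1 = 0\<close> by (simp add: bracket_decomposed V_closed rank1)
    qed
    then show False using nonabelian by (simp add: abelian_on_def)
  qed

  let ?K = "{v \<in> V. \<beta> v = 0}"
  have K: "subspace ?K" by (auto simp: subspace_def lin V_closed \<beta>_zero)
  have central: "bracket x k = 0" "bracket k x = 0" if "k \<in> ?K" for x k
  proof -
    obtain v t where "v \<in> V" "x = v + scale t e0" by (rule decompose)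
    then show "bracket x k = 0"
      using that by (simp add: bracket_bilinear abelian_V rank1)
    then show "bracket k x = 0" by (simp add: bracket_swap[of k x])
  qed

  \<comment> \<open>The span of \<open>B - {e1}\<close> is a complement of \<open>e1\<close> in \<open>ker \<beta>\<close>.\<close>
  obtain B where B: "{e1} \<subseteq> B" "B \<subseteq> ?K" "independent B" "?K \<subseteq> span B"
    using maximal_independent_subset_extend[of "{e1}" ?K] e1 e1_nz by auto
  let ?W = "span (B - {e1})"
  have WK: "?W \<subseteq> ?K" by (rule span_minimal[OF _ K]) (use B in auto)

  define \<psi> where "\<psi> = (\<lambda>(x0, x1, x2). scale x2 u + scale x1 e1 + scale x0 e0)"
  interpret H: lie_algebra "heisenberg_scale :: 'f \<Rightarrow> _" heisenberg_bracket
    by (rule lie_algebra_heisenberg)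
  have \<psi>_add: "\<psi> (x + y) = \<psi> x + \<psi> y" for x y
    by (cases x; cases y) (simp add: \<psi>_def algebra_simps)
  have \<psi>_scale: "\<psi> (heisenberg_scale c x) = scale c (\<psi> x)" for c x
    by (cases x) (simp add: \<psi>_def heisenberg_scale_def algebra_simps)
  have \<psi>_linear: "Vector_Spaces.linear heisenberg_scale scale \<psi>"
    by (simp add: linear_iff_linear_on_UNIV[OF H.vector_space_axioms vector_space_axioms]
        linear_on_def \<psi>_add \<psi>_scale)
  interpret \<psi>: Vector_Spaces.linear heisenberg_scale scale \<psi> by (rule \<psi>_linear)
  have \<psi>_bracket: "\<psi> (heisenberg_bracket x y) = bracket (\<psi> x) (\<psi> y)" for x y
  proof (cases x; cases y)
    fix x0 x1 x2 y0 y1 y2 assume xy: "x = (x0, x1, x2)" "y = (y0, y1, y2)"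
    have "bracket (\<psi> x) (\<psi> y)
        = bracket e0 (scale x0 (scale y2 u + scale y1 e1) - scale y0 (scale x2 u + scale x1 e1))"
      unfolding xy \<psi>_def prod.case using u e1 by (intro bracket_decomposed) (auto intro!: V_closed)
    also have "\<dots> = scale (x0 * y2 - x2 * y0) e1"
      using central(1)[of e1 e0] e1
      by (simp add: bracket_bilinear e1_def[symmetric] algebra_simps)
    also have "\<dots> = \<psi> (heisenberg_bracket x y)" by (simp add: xy \<psi>_def heisenberg_bracket_def)
    finally show ?thesis ..
  qed

  \<comment> \<open>Taking \<open>e0\<close>-coordinates, then \<open>\<beta>\<close>, then independence of \<open>B\<close>, removes the coefficients one by one.\<close>
  have \<psi>_in_W: "x = 0" if "\<psi> x \<in> ?W" for x
  proof (cases x)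
    case (fields x0 x1 x2)
    have W: "(scale x2 u + scale x1 e1) + scale x0 e0 \<in> ?W"
      using that by (simp add: fields \<psi>_def)
    then have "(scale x2 u + scale x1 e1) + scale x0 e0 \<in> V" using WK by blast
    then have "e0_coordinate ((scale x2 u + scale x1 e1) + scale x0 e0) = 0"
      by (intro e0_coordinate_eqI) simp
    moreover have "e0_coordinate ((scale x2 u + scale x1 e1) + scale x0 e0) = x0"
      using u e1 by (intro e0_coordinate_sum) (auto intro!: V_closed)
    ultimately have x0: "x0 = 0" by simp
    have "\<beta> (scale x2 u + scale x1 e1) = 0" using W WK x0 by auto
    then have x2: "x2 = 0" using u e1 by (simp add: lin V_closed)
    have "scale x1 e1 \<in> ?W" using W by (simp add: x0 x2)
    then have "x1 \<noteq> 0 \<Longrightarrow> e1 \<in> ?W"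
      using span_scale[of "scale x1 e1" "B - {e1}" "inverse x1"] by simp
    then have "x1 = 0" using B(1,3) by (auto simp: dependent_def)
    with x0 x2 show ?thesis by (simp add: fields zero_prod_def)
  qed
  have \<psi>_W_sum: "\<exists>y. \<exists>w\<in>?W. x = \<psi> y + w" for x
  proof -
    obtain v t where v: "v \<in> V" and x: "x = v + scale t e0" by (rule decompose)
    have "v - scale (\<beta> v) u \<in> V" using u v V_closed by auto
    moreover have "\<beta> v = \<beta> (v - scale (\<beta> v) u) + \<beta> (scale (\<beta> v) u)"
      using lin(1)[OF \<open>v - scale (\<beta> v) u \<in> V\<close> V_closed(3)[OF u(1)], of "\<beta> v"] by simp
    ultimately have "v - scale (\<beta> v) u \<in> span B" using u B(4) lin(2) by auto
    then obtain k where k: "v - scale (\<beta> v) u - scale k e1 \<in> ?W"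
      using span_breakdown[of e1 B] B(1) by blast
    have "x = \<psi> (t, k, \<beta> v) + (v - scale (\<beta> v) u - scale k e1)" by (simp add: x \<psi>_def)
    with k show ?thesis by blast
  qed

  have "is_direct_sum (range \<psi>) ?W"
    unfolding is_direct_sum_def
  proof (intro conjI)
    show "subspace (range \<psi>)"
      using \<psi>.subspace_image[OF H.subspace_UNIV] by simp
    show "range \<psi> \<inter> ?W = {0}"
    proof (intro equalityI subsetI)
      fix x assume "x \<in> range \<psi> \<inter> ?W"
      then obtain y where "x = \<psi> y" "\<psi> y \<in> ?W" by blast
      then have "x = \<psi> 0" using \<psi>_in_W by metis
      then show "x \<in> {0}" using \<psi>.zero by simp
    next
      fix x :: 'l assume "x \<in> {0}"
      then have "x = \<psi> 0" "x \<in> ?W" using \<psi>.zero span_zero by simp_all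
      then show "x \<in> range \<psi> \<inter> ?W" by blast
    qed
    show "{a + w |a w. a \<in> range \<psi> \<and> w \<in> ?W} = UNIV" using \<psi>_W_sum by blast
  qed (rule subspace_span)
  moreover have "range \<psi> \<noteq> {0}"
  proof -
    have "\<psi> (0, 1, 0) = e1" by (simp add: \<psi>_def)
    then show ?thesis using e1_nz by (metis rangeI singletonD)
  qed
  moreover have "lie_subalgebra (range \<psi>)"
    using \<psi>.subspace_image[OF H.subspace_UNIV]
    by (auto simp: lie_subalgebra_def \<psi>_bracket[symmetric])
  moreover have "bracket a w = 0" if "w \<in> ?W" for a w
    using central(1) WK that by blast
  moreover from this have "lie_subalgebra ?W" by (simp add: lie_subalgebra_def span_zero)
  ultimately have W0: "?W = {0}"
    using indecomposable unfolding decomposable_def by blast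
  have "surj \<psi>"
    unfolding surj_def using \<psi>_W_sum W0 by fastforce
  moreover have "inj \<psi>"
    using \<psi>_in_W span_zero by (auto simp: \<psi>.inj_iff_eq_0)
  ultimately have "lie_isomorphic heisenberg_scale heisenberg_bracket scale bracket"
    unfolding lie_isomorphic_def bij_def using \<psi>_linear \<psi>_bracket by blast
  then show ?thesis by (rule lie_isomorphic_sym)
qed

text \<open>
  Identify the algebra with the Heisenberg algebra; then \<open>[e0, v] = f(v) e1\<close> for a functional \<open>f\<close>.
  Where \<open>f(v)\<close> or \<open>f(w)\<close> is nonzero, commutativity of \<open>V\<close> forces the kernel of \<open>f\<close> on \<open>V\<close> into the
  line of \<open>e1\<close>, on which \<open>\<beta>\<close> vanishes. Since \<open>f(v) w - f(w) v\<close> lies in that kernel, it is killed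
  by \<open>\<beta>\<close>; this is the claimed identity.
\<close>

lemma exchange_if_heisenberg:
  assumes heis: "lie_isomorphic scale bracket heisenberg_scale heisenberg_bracket"
    and \<beta>: "\<beta> \<in> dual_on V" and ker: "\<And>v. v \<in> V \<Longrightarrow> \<beta> (bracket e0 v) = 0"
    and v: "v \<in> V" and w: "w \<in> V"
  shows "scale (\<beta> v) (bracket e0 w) = scale (\<beta> w) (bracket e0 v)"
proof -
  have lin: "\<And>x y. x \<in> V \<Longrightarrow> y \<in> V \<Longrightarrow> \<beta> (x + y) = \<beta> x + \<beta> y"
    "\<And>c x. x \<in> V \<Longrightarrow> \<beta> (scale c x) = c * \<beta> x"
    using \<beta> by (auto simp: dual_on_def linear_on_def)
  obtain \<phi> where "Vector_Spaces.linear scale heisenberg_scale \<phi>" and "bij \<phi>"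
    and hom: "\<And>x y. \<phi> (bracket x y) = heisenberg_bracket (\<phi> x) (\<phi> y)"
    using heis by (auto simp: lie_isomorphic_def)
  then interpret \<phi>: Vector_Spaces.linear scale heisenberg_scale \<phi> by simp
  have inj: "x = y" if "\<phi> x = \<phi> y" for x y
    using \<open>bij \<phi>\<close> that by (meson bij_is_inj injD)
  obtain a b c where e0: "\<phi> e0 = (a, b, c)" by (metis surj_pair)
  define f where "f x = a * snd (snd (\<phi> x)) - c * fst (\<phi> x)" for x
  have \<phi>_bracket: "\<phi> (bracket e0 x) = (0, f x, 0)" for x
    by (cases "\<phi> x") (simp add: hom e0 heisenberg_bracket_def f_def)
  have f_diff: "f (scale s x - scale t y) = s * f x - t * f y" for s t x y
    by (cases "\<phi> x"; cases "\<phi> y")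
      (simp add: f_def \<phi>.diff \<phi>.scale heisenberg_scale_def algebra_simps)
  have kernel: "\<beta> x = 0" if x: "x \<in> V" and fx: "f x = 0" and y: "y \<in> V" and fy: "f y \<noteq> 0" for x y
  proof -
    obtain x0 x1 x2 where X: "\<phi> x = (x0, x1, x2)" by (metis surj_pair)
    obtain y0 y1 y2 where Y: "\<phi> y = (y0, y1, y2)" by (metis surj_pair)
    have "\<phi> (bracket y x) = 0" by (simp add: abelian_V x y \<phi>.zero)
    then have 1: "y0 * x2 = y2 * x0" by (simp add: hom X Y heisenberg_bracket_def zero_prod_def)
    have 2: "a * x2 = c * x0" using fx by (simp add: f_def X)
    have d: "a * y2 - c * y0 \<noteq> 0" using fy by (simp add: f_def Y)
    \<comment> \<open>Cramer's rule for the equations \<open>1\<close> and \<open>2\<close>, whose determinant is \<open>f y\<close>.\<close>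
    have "(a * y2 - c * y0) * x0 = 0" "(a * y2 - c * y0) * x2 = 0"
      using 1 2 by algebra+
    then have "\<phi> x = (0, x1, 0)" using d X by simp
    also have "\<dots> = \<phi> (bracket e0 (scale (x1 / f y) y))"
      using fy by (simp add: bracket_bilinear \<phi>.scale \<phi>_bracket heisenberg_scale_def)
    finally have "x = bracket e0 (scale (x1 / f y) y)" by (rule inj)
    then show ?thesis using ker V_closed(3)[OF y] by metis
  qed
  have "f v * \<beta> w = f w * \<beta> v"
  proof (cases "f v = 0 \<and> f w = 0")
    case False
    let ?z = "scale (f v) w - scale (f w) v"
    have z: "?z \<in> V" using v w V_closed by auto
    have "f ?z = 0" by (simp add: f_diff)
    then have "\<beta> ?z = 0" using kernel z v w False by blast
    then have "\<beta> (scale (f v) w) = \<beta> (scale (f w) v)"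
      using lin(1)[OF z V_closed(3)[OF v], of "f w"] by simp
    then show ?thesis using v w by (simp add: lin)
  qed auto
  then have "\<phi> (scale (\<beta> v) (bracket e0 w)) = \<phi> (scale (\<beta> w) (bracket e0 v))"
    by (simp add: \<phi>.scale \<phi>_bracket heisenberg_scale_def algebra_simps)
  then show ?thesis by (rule inj)
qed

end

section \<open>Derivations of indecomposable almost Abelian Lie algebras\<close>

theorem proposition13:
  fixes scale :: "'f::field \<Rightarrow> 'l::ab_group_add \<Rightarrow> 'l"
    and bracket :: "'l \<Rightarrow> 'l \<Rightarrow> 'l"
    and V :: "'l set" and e0 :: 'l
  assumes "lie_algebra scale bracket"
    and "lie_algebra.almost_abelian scale bracket"
    and "\<not> lie_algebra.decomposable scale bracket"
    and "lie_algebra.semidirect_decomposition scale bracket V e0"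
  shows "lie_algebra.derivations scale bracket =
    {lie_algebra.block_operator scale V e0 \<Delta> \<gamma> \<beta> \<alpha> | \<Delta> \<gamma> \<beta> \<alpha>.
       \<beta> \<in> lie_algebra.dual_on scale V \<and> \<gamma> \<in> V \<and> \<Delta> \<in> lie_algebra.endomorphisms_on scale V \<and>
       lie_algebra.derived_algebra scale bracket \<subseteq> {v \<in> V. \<beta> v = 0} \<and>
       (\<forall>v\<in>V. (\<Delta> (bracket e0 v) - scale \<alpha> (bracket e0 v)) - bracket e0 (\<Delta> v) = 0) \<and>
       (\<not> lie_isomorphic scale bracket heisenberg_scale heisenberg_bracket \<longrightarrow>
          (\<forall>v\<in>V. \<beta> v = 0))}"
proof -
  interpret lie_algebra scale bracket by (rule assms(1))
  interpret abelian_ideal_decomposition scale bracket V e0 by unfold_locales (rule assms(4))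
  have nonabelian: "\<not> abelian_on UNIV" using assms(2) by (simp add: almost_abelian_def)
  have exchange_iff: "(\<forall>v\<in>V. \<forall>w\<in>V. scale (\<beta> v) (bracket e0 w) = scale (\<beta> w) (bracket e0 v)) \<longleftrightarrow>
      (\<not> lie_isomorphic scale bracket heisenberg_scale heisenberg_bracket \<longrightarrow> (\<forall>v\<in>V. \<beta> v = 0))"
    if "\<beta> \<in> dual_on V" "\<forall>v\<in>V. \<beta> (bracket e0 v) = 0" for \<beta>
    using heisenberg_if_exchange[OF nonabelian assms(3) that(1)]
      exchange_if_heisenberg[OF _ that(1)] that(2)
    by (metis scale_zero_left)
  have derivation_iff: "block_operator V e0 \<Delta> \<gamma> \<beta> \<alpha> \<in> derivations \<longleftrightarrow>
      derived_algebra \<subseteq> {v \<in> V. \<beta> v = 0} \<and>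
      (\<forall>v\<in>V. (\<Delta> (bracket e0 v) - scale \<alpha> (bracket e0 v)) - bracket e0 (\<Delta> v) = 0) \<and>
      (\<not> lie_isomorphic scale bracket heisenberg_scale heisenberg_bracket \<longrightarrow> (\<forall>v\<in>V. \<beta> v = 0))"
    if "\<beta> \<in> dual_on V" "\<gamma> \<in> V" "\<Delta> \<in> endomorphisms_on V" for \<Delta> \<gamma> \<beta> \<alpha>
    unfolding block_operator_derivation_iff[OF that] derived_algebra_subset_kernel_iff[OF that(1)]
    using exchange_iff[OF that(1)] by blast
  show ?thesis (is "_ = ?blocks")
  proof (intro equalityI subsetI)
    fix D assume D: "D \<in> derivations"
    then have "Vector_Spaces.linear scale scale D" by (simp add: derivations_def)
    then obtain \<Delta> \<gamma> \<beta> \<alpha> where "D = block_operator V e0 \<Delta> \<gamma> \<beta> \<alpha>"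
      and "\<beta> \<in> dual_on V" "\<gamma> \<in> V" "\<Delta> \<in> endomorphisms_on V"
      by (rule linear_eq_block_operator)
    then show "D \<in> ?blocks" using D derivation_iff by blast
  next
    fix D assume "D \<in> ?blocks"
    then show "D \<in> derivations" using derivation_iff by blast
  qed
qed

end
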